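(* Let $G$ be a finite abelian group of order $n$, and let $S\subseteq G$ be a subset satisfying $S\cap S^{-1}=\emptyset$. Then the oriented Cayley graph $\mathrm{Cay}(G,S)$ does not admit $(\alpha,\beta)$-FR with $\alpha,\beta\neq0$; that is, there are no distinct vertices $u,v$, no time $t\in\mathbb{R}$ and no nonzero real numbers $\alpha,\beta$ such that $\mathrm{Cay}(G,S)$ admits $(\alpha,\beta)$-FR from $u$ to $v$ at time $t$.
   Context: An oriented graph $\Gamma$ is a finite graph with vertex set $V(\Gamma)$ and edge set $E(\Gamma)\subseteq V(\Gamma)\times V(\Gamma)$ such that $(u,v)\in E(\Gamma)$ implies $(v,u)\notin E(\Gamma)$. Its adjacency matrix $A_\Gamma=[a_{uv}]$ has $a_{uv}=1$ if $(u,v)\in E(\Gamma)$, $a_{uv}=-1$ if $(v,u)\in E(\Gamma)$, and $a_{uv}=0$ otherwise. The transition matrix is $U(t)=\exp(A_\Gamma t)$, $t\in\mathbb{R}$. $\mathbf{e}_u$ is the standard basis vector indexed by $u$. Fractional revival: for distinct vertices $u,v$ and real numbers $\alpha,\beta$ with $\alpha^2+\beta^2=1$, $\beta\neq0$, $\Gamma$ admits $(\alpha,\beta)$-FR from $u$ to $v$ at time $t$ if $U(t)\mathbf{e}_u=\alpha\mathbf{e}_u+\beta\mathbf{e}_v$. For a subset $S$ of $G$, $S^{-1}=\{s^{-1}\mid s\in S\}$. If $S\cap S^{-1}=\emptyset$, the oriented Cayley graph $\mathrm{Cay}(G,S)$ has vertex set $G$ and an oriented edge from $u$ to $v$ if and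 only if $u^{-1}v\in S$. *)

theory Defs
  imports Complex_Main "HOL-Algebra.Coset" "Graph_Theory.Pair_Digraph"
begin

section \<open>Oriented graphs\<close>

text \<open>Loops are excluded by the case \<open>u = v\<close> of \<open>antisymmetric\<close>.\<close>

locale oriented_graph = pair_fin_digraph +
  assumes antisymmetric: "(u, v) \<in> parcs G \<Longrightarrow> (v, u) \<notin> parcs G"

definition adjacency :: "'v pair_pre_digraph \<Rightarrow> 'v \<Rightarrow> 'v \<Rightarrow> real" where
  "adjacency \<Gamma> u v =
     (if (u, v) \<in> parcs \<Gamma> then 1 else if (v, u) \<in> parcs \<Gamma> then - 1 else 0)"


section \<open>Matrices indexed by a finite set\<close>

text \<open>A real matrix with rows and columns indexed by a finite set \<open>V\<close> is a function
  \<open>'v \<Rightarrow> 'v \<Rightarrow> real\<close>, and a vector a function \<open>'v \<Rightarrow> real\<close>, of which only the values on \<open>V\<close>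
  are relevant.\<close>

definition mat_mult :: "'v set \<Rightarrow> ('v \<Rightarrow> 'v \<Rightarrow> real) \<Rightarrow> ('v \<Rightarrow> 'v \<Rightarrow> real) \<Rightarrow> 'v \<Rightarrow> 'v \<Rightarrow> real" where
  "mat_mult V A B x y = (\<Sum>z\<in>V. A x z * B z y)"

definition mat_vec :: "'v set \<Rightarrow> ('v \<Rightarrow> 'v \<Rightarrow> real) \<Rightarrow> ('v \<Rightarrow> real) \<Rightarrow> 'v \<Rightarrow> real" where
  "mat_vec V A b x = (\<Sum>z\<in>V. A x z * b z)"

definition mat_one :: "'v \<Rightarrow> 'v \<Rightarrow> real" where
  "mat_one x y = (if x = y then 1 else 0)"

definition unit_vec :: "'v \<Rightarrow> 'v \<Rightarrow> real" where
  "unit_vec u x = (if x = u then 1 else 0)"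

primrec mat_pow :: "'v set \<Rightarrow> ('v \<Rightarrow> 'v \<Rightarrow> real) \<Rightarrow> nat \<Rightarrow> 'v \<Rightarrow> 'v \<Rightarrow> real" where
  "mat_pow V A 0 = mat_one"
| "mat_pow V A (Suc k) = mat_mult V A (mat_pow V A k)"

text \<open>The exponential is the entrywise sum of the power series, which converges by
  \<open>summable_mat_exp\<close> below.\<close>

definition mat_exp :: "'v set \<Rightarrow> ('v \<Rightarrow> 'v \<Rightarrow> real) \<Rightarrow> 'v \<Rightarrow> 'v \<Rightarrow> real" where
  "mat_exp V A x y = (\<Sum>k. mat_pow V A k x y / fact k)"

lemma mat_pow_bound:
  assumes "finite V" "x \<in> V"
  shows "\<bar>mat_pow V A k x y\<bar> \<le> (\<Sum>a\<in>V. \<Sum>b\<in>V. \<bar>A a b\<bar>) ^ k"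
  using assms(2)
proof (induction k arbitrary: x)
  case 0
  then show ?case by (simp add: mat_one_def)
next
  case (Suc k)
  let ?c = "\<Sum>a\<in>V. \<Sum>b\<in>V. \<bar>A a b\<bar>"
  have c0: "0 \<le> ?c" by (intro sum_nonneg) auto
  have row: "(\<Sum>b\<in>V. \<bar>A x b\<bar>) \<le> ?c"
    using member_le_sum[of x V "\<lambda>a. \<Sum>b\<in>V. \<bar>A a b\<bar>"] Suc.prems assms(1)
    by (simp add: sum_nonneg)
  have "\<bar>mat_pow V A (Suc k) x y\<bar> \<le> (\<Sum>z\<in>V. \<bar>A x z * mat_pow V A k z y\<bar>)"
    by (simp add: mat_mult_def)
  also have "\<dots> \<le> (\<Sum>z\<in>V. \<bar>A x z\<bar> * ?c ^ k)"
    using Suc.IH by (intro sum_mono) (auto simp: abs_mult intro!: mult_left_mono)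
  also have "\<dots> = (\<Sum>z\<in>V. \<bar>A x z\<bar>) * ?c ^ k"
    by (simp add: sum_distrib_right)
  also have "\<dots> \<le> ?c * ?c ^ k"
    using row c0 by (intro mult_right_mono) auto
  finally show ?case by simp
qed

lemma summable_mat_exp:
  assumes "finite V" "x \<in> V"
  shows "summable (\<lambda>k. mat_pow V A k x y / fact k)"
proof (rule summable_comparison_test[OF _ summable_exp])
  let ?c = "\<Sum>a\<in>V. \<Sum>b\<in>V. \<bar>A a b\<bar>"
  show "\<exists>N. \<forall>k\<ge>N. norm (mat_pow V A k x y / fact k) \<le> inverse (fact k) * ?c ^ k"
    using mat_pow_bound[OF assms] by (auto simp: field_simps)
qed


section \<open>Transition matrix and fractional revival\<close>

definition transition :: "'v pair_pre_digraph \<Rightarrow> real \<Rightarrow> 'v \<Rightarrow> 'v \<Rightarrow> real" where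
  "transition \<Gamma> t = mat_exp (pverts \<Gamma>) (\<lambda>x y. adjacency \<Gamma> x y * t)"

definition admits_FR ::
    "'v pair_pre_digraph \<Rightarrow> real \<Rightarrow> real \<Rightarrow> 'v \<Rightarrow> 'v \<Rightarrow> real \<Rightarrow> bool" where
  "admits_FR \<Gamma> \<alpha> \<beta> u v t \<longleftrightarrow>
     u \<in> pverts \<Gamma> \<and> v \<in> pverts \<Gamma> \<and> u \<noteq> v \<and> \<alpha>^2 + \<beta>^2 = 1 \<and> \<beta> \<noteq> 0 \<and>
     (\<forall>x\<in>pverts \<Gamma>. mat_vec (pverts \<Gamma>) (transition \<Gamma> t) (unit_vec u) x
                     = \<alpha> * unit_vec u x + \<beta> * unit_vec v x)"


section \<open>Oriented Cayley graphs\<close>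

definition Cay :: "('a, 'b) monoid_scheme \<Rightarrow> 'a set \<Rightarrow> 'a pair_pre_digraph" where
  "Cay G S = \<lparr> pverts = carrier G,
     parcs = {(u, v). u \<in> carrier G \<and> v \<in> carrier G \<and> inv\<^bsub>G\<^esub> u \<otimes>\<^bsub>G\<^esub> v \<in> S} \<rparr>"

lemma oriented_graph_Cay:
  assumes "group G" "finite (carrier G)" and S: "S \<inter> set_inv\<^bsub>G\<^esub> S = {}"
  shows "oriented_graph (Cay G S)"
proof
  interpret group G by fact
  show "fst e \<in> pverts (Cay G S)" "snd e \<in> pverts (Cay G S)" if "e \<in> parcs (Cay G S)" for e
    using that by (auto simp: Cay_def)
  show "finite (pverts (Cay G S))" by (simp add: Cay_def assms)
  show "finite (parcs (Cay G S))"
    by (rule finite_subset[of _ "carrier G \<times> carrier G"]) (auto simp: Cay_def assms)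
  show "(v, u) \<notin> parcs (Cay G S)" if "(u, v) \<in> parcs (Cay G S)" for u v
  proof
    assume "(v, u) \<in> parcs (Cay G S)"
    with that have *: "u \<in> carrier G" "v \<in> carrier G"
      "inv\<^bsub>G\<^esub> u \<otimes>\<^bsub>G\<^esub> v \<in> S" "inv\<^bsub>G\<^esub> v \<otimes>\<^bsub>G\<^esub> u \<in> S"
      by (auto simp: Cay_def)
    have "inv\<^bsub>G\<^esub> u \<otimes>\<^bsub>G\<^esub> v = inv\<^bsub>G\<^esub> (inv\<^bsub>G\<^esub> v \<otimes>\<^bsub>G\<^esub> u)"
      using * by (simp add: inv_mult_group)
    then have "inv\<^bsub>G\<^esub> u \<otimes>\<^bsub>G\<^esub> v \<in> set_inv\<^bsub>G\<^esub> S"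
      using * by (auto simp: SET_INV_def)
    with * S show False by blast
  qed
qed

end

(* The transition matrix U of an oriented graph is orthogonal, its exponent being skew-symmetric,
   and it commutes with every automorphism, in particular with the left translations of a Cayley
   graph. If the column of u is alpha e_u + beta e_v, then translating by v u^-1 shows that the
   column of v is alpha e_v + beta e_w with w = v u^-1 v different from v. The inner product of
   these two columns is alpha beta or 2 alpha beta, whereas orthogonality forces it to vanish. *)
theory Submission
  imports Defs
begin

lemma mat_mult_one_left:
  assumes "finite V" "x \<in> V"
  shows "mat_mult V mat_one B x y = B x y"
proof -
  have "mat_mult V mat_one B x y = (\<Sum>z\<in>V. if x = z then B z y else 0)"
    unfolding mat_mult_def by (intro sum.cong) (auto simp: mat_one_def)
  then show ?thesis using assms by simp
qed

lemma mat_vec_unit: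
  assumes "finite V" "u \<in> V"
  shows "mat_vec V A (unit_vec u) x = A x u"
proof -
  have "mat_vec V A (unit_vec u) x = (\<Sum>z\<in>V. if u = z then A x z else 0)"
    unfolding mat_vec_def by (intro sum.cong) (auto simp: unit_vec_def)
  then show ?thesis using assms by simp
qed

lemma mat_mult_one_right:
  assumes "finite V" "y \<in> V"
  shows "mat_mult V A mat_one x y = A x y"
  using mat_vec_unit[OF assms] by (simp add: mat_mult_def mat_vec_def mat_one_def unit_vec_def)

lemma mat_mult_assoc: "mat_mult V (mat_mult V A B) C = mat_mult V A (mat_mult V B C)"
proof (intro ext)
  fix x y
  show "mat_mult V (mat_mult V A B) C x y = mat_mult V A (mat_mult V B C) x y"
    unfolding mat_mult_def sum_distrib_left sum_distrib_right
    by (subst sum.swap) (simp add: mult.assoc)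
qed

text \<open>The row index must lie in \<open>V\<close>, since \<open>mat_one\<close> is a left
  identity only on such rows. The induction hypothesis is therefore an identity of entries, applied
  under the sum once associativity has isolated \<open>A\<close>.\<close>

lemma mat_mult_pow_pow:
  assumes "finite V" "x \<in> V"
  shows "mat_mult V (mat_pow V A k) (mat_pow V A l) x y = mat_pow V A (k + l) x y"
  using assms(2)
proof (induction k arbitrary: x)
  case 0
  then show ?case by (simp add: mat_mult_one_left assms(1))
next
  case (Suc k)
  show ?case
    using Suc.IH by (simp add: mat_mult_assoc) (simp add: mat_mult_def)
qed

text \<open>Transposition reverses products and turns each factor \<open>A\<close> into its
  negative, so \<open>k\<close> factors contribute the sign \<open>(- 1) ^ k\<close>.\<close>

lemma mat_pow_skew:
  assumes "finite V" and skew: "\<And>x y. x \<in> V \<Longrightarrow> y \<in> V \<Longrightarrow> A y x = - A x y"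
    and "x \<in> V" "y \<in> V"
  shows "mat_pow V A k y x = (- 1) ^ k * mat_pow V A k x y"
  using assms(4)
proof (induction k arbitrary: y)
  case 0
  then show ?case by (simp add: mat_one_def)
next
  case (Suc k)
  have "mat_pow V A (Suc k) y x = (\<Sum>z\<in>V. A y z * mat_pow V A k z x)"
    by (simp add: mat_mult_def)
  \<comment> \<open>Transposing leaves the new factor on the right, while the recursion of
    \<open>mat_pow\<close> adds factors on the left. Written as a first power, it is absorbed by
    \<open>mat_mult_pow_pow\<close>.\<close>
  also have "\<dots> = (\<Sum>z\<in>V. (- 1) ^ Suc k * (mat_pow V A k x z * mat_pow V A 1 z y))"
  proof (rule sum.cong)
    fix z assume "z \<in> V"
    then show "A y z * mat_pow V A k z x
        = (- 1) ^ Suc k * (mat_pow V A k x z * mat_pow V A 1 z y)"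
      using Suc.IH[of z] skew[of z y] Suc.prems mat_mult_one_right[OF assms(1) Suc.prems]
      by simp
  qed simp
  also have "\<dots> = (- 1) ^ Suc k * mat_mult V (mat_pow V A k) (mat_pow V A 1) x y"
    unfolding mat_mult_def sum_distrib_left by simp
  also have "\<dots> = (- 1) ^ Suc k * mat_pow V A (Suc k) x y"
    unfolding mat_mult_pow_pow[OF assms(1,3)] by simp
  finally show ?case .
qed

text \<open>Absolute convergence is what the Cauchy product of two exponential series
  requires.\<close>

lemma summable_norm_mat_exp:
  assumes "finite V" "x \<in> V"
  shows "summable (\<lambda>k. norm (mat_pow V A k x y / fact k))"
proof (rule summable_comparison_test[OF _ summable_exp])
  let ?c = "\<Sum>a\<in>V. \<Sum>b\<in>V. \<bar>A a b\<bar>"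
  show "\<exists>N. \<forall>k\<ge>N. norm (norm (mat_pow V A k x y / fact k)) \<le> inverse (fact k) * ?c ^ k"
    using mat_pow_bound[OF assms] by (auto simp: field_simps)
qed

text \<open>These are the coefficients of exp(-x) exp(x) = 1; multiplied by \<open>fact n\<close>
  they become the binomial expansion of (1 - 1)^n.\<close>

lemma sum_alternating_inverse_fact:
  "(\<Sum>i\<le>n. (- 1) ^ i / (fact i * fact (n - i) :: real)) = (if n = 0 then 1 else 0)"
proof -
  have "(\<Sum>i\<le>n. (- 1) ^ i / (fact i * fact (n - i) :: real))
      = (\<Sum>i\<le>n. (- 1) ^ i * real (n choose i) / fact n)"
    by (intro sum.cong) (auto simp: binomial_fact)
  also have "\<dots> = (\<Sum>i\<le>n. (- 1) ^ i * real (n choose i)) / fact n"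
    by (simp add: sum_divide_distrib)
  finally show ?thesis
    using choose_alternating_sum[of n, where 'a = real] by auto
qed

text \<open>The transpose of exp(A) is exp(-A), its inverse. This is checked on the Cauchy product
  of the series, where only the term of degree 0 survives.\<close>

lemma mat_exp_skew_orthogonal:
  assumes "finite V" and skew: "\<And>x y. x \<in> V \<Longrightarrow> y \<in> V \<Longrightarrow> A y x = - A x y"
    and "u \<in> V" "v \<in> V"
  shows "(\<Sum>z\<in>V. mat_exp V A z u * mat_exp V A z v) = mat_one u v"
proof -
  let ?P = "mat_pow V A"
  let ?c = "\<lambda>z n. \<Sum>i\<le>n. (?P i z u / fact i) * (?P (n - i) z v / fact (n - i))"
  have "(\<lambda>n. \<Sum>z\<in>V. ?c z n) sums (\<Sum>z\<in>V. mat_exp V A z u * mat_exp V A z v)"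
    unfolding mat_exp_def
    by (intro sums_sum Cauchy_product_sums summable_norm_mat_exp assms(1))
  moreover have "(\<Sum>z\<in>V. ?c z n) = (if n = 0 then mat_one u v else 0)" for n
  proof -
    \<comment> \<open>Skewness swaps the indices of the first power at the cost of
      \<open>(- 1) ^ i\<close>. The sum over \<open>z\<close> is then an entry of the
      \<open>n\<close>-th power for every \<open>i\<close>, leaving a scalar alternating sum as its
      coefficient.\<close>
    have "(\<Sum>z\<in>V. ?c z n)
        = (\<Sum>i\<le>n. \<Sum>z\<in>V. (- 1) ^ i / (fact i * fact (n - i)) * (?P i u z * ?P (n - i) z v))"
      by (subst sum.swap)
        (intro sum.cong refl, simp add: mat_pow_skew[of V A u, OF assms(1) skew assms(3)])
    also have "\<dots> = (\<Sum>i\<le>n. (- 1) ^ i / (fact i * fact (n - i)) * ?P n u v)"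
      unfolding sum_distrib_left[symmetric] mat_mult_pow_pow[OF assms(1,3), unfolded mat_mult_def]
      by (intro sum.cong) auto
    also have "\<dots> = (\<Sum>i\<le>n. (- 1) ^ i / (fact i * fact (n - i))) * ?P n u v"
      by (rule sum_distrib_right[symmetric])
    finally show ?thesis
      by (simp add: sum_alternating_inverse_fact)
  qed
  ultimately show ?thesis
    using sums_unique2 sums_single[of 0 "\<lambda>_. mat_one u v"] by fastforce
qed

text \<open>Each power is invariant: injectivity of \<open>f\<close> settles the identity matrix,
  and reindexing the inner sum along \<open>f\<close> gives the induction step.\<close>

lemma mat_exp_automorphism:
  assumes bij: "bij_betw f V V" and inv: "\<And>x y. x \<in> V \<Longrightarrow> y \<in> V \<Longrightarrow> A (f x) (f y) = A x y"
    and "x \<in> V" "y \<in> V"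
  shows "mat_exp V A (f x) (f y) = mat_exp V A x y"
proof -
  have "mat_pow V A k (f x) (f y) = mat_pow V A k x y" for k
    using assms(3)
  proof (induction k arbitrary: x)
    case 0
    then show ?case
      using bij assms(4) by (auto simp: mat_one_def bij_betw_def inj_on_eq_iff)
  next
    case (Suc k)
    have "mat_pow V A (Suc k) (f x) (f y) = (\<Sum>z\<in>V. A (f x) (f z) * mat_pow V A k (f z) (f y))"
      using sum.reindex_bij_betw[OF bij, of "\<lambda>z. A (f x) z * mat_pow V A k z (f y)"]
      by (simp add: mat_mult_def)
    then show ?case
      using Suc inv by (simp add: mat_mult_def)
  qed
  then show ?thesis by (simp add: mat_exp_def)
qed

text \<open>Having neither opposite arcs nor loops makes the adjacency matrix skew-symmetric with
  zero diagonal, and scaling by \<open>t\<close> preserves this.\<close>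

lemma (in oriented_graph) transition_orthogonal:
  assumes "u \<in> pverts G" "v \<in> pverts G"
  shows "(\<Sum>z\<in>pverts G. transition G t z u * transition G t z v) = mat_one u v"
  unfolding transition_def
  using assms antisymmetric by (intro mat_exp_skew_orthogonal) (auto simp: adjacency_def)

text \<open>Left translation by \<open>h\<close> is a bijection that preserves the quotients
  deciding adjacency, hence an automorphism of the Cayley graph.\<close>

lemma (in group) transition_Cay_translate:
  assumes "h \<in> carrier G" "x \<in> carrier G" "y \<in> carrier G"
  shows "transition (Cay G S) t (h \<otimes> x) (h \<otimes> y) = transition (Cay G S) t x y"
proof -
  have bij: "bij_betw ((\<otimes>) h) (carrier G) (carrier G)"
    using assms(1) by (simp add: bij_betw_def inj_on_multc inj_on_cmult surj_const_mult)
  have "inv (h \<otimes> a) \<otimes> (h \<otimes> b) = inv a \<otimes> b" if "a \<in> carrier G" "b \<in> carrier G" for a b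
  proof -
    have "inv h \<otimes> (h \<otimes> b) = b"
      using that assms(1) by (simp flip: m_assoc)
    then show ?thesis
      using that assms(1) by (simp add: inv_mult_group m_assoc)
  qed
  then have "adjacency (Cay G S) (h \<otimes> a) (h \<otimes> b) = adjacency (Cay G S) a b"
    if "a \<in> carrier G" "b \<in> carrier G" for a b
    using that assms(1) by (simp add: adjacency_def Cay_def)
  then show ?thesis
    using assms mat_exp_automorphism[OF bij] by (simp add: transition_def Cay_def)
qed

theorem theorem3p3:
  fixes G :: "('a, 'b) monoid_scheme" and S :: "'a set" and n :: nat
  assumes "comm_group G" and "finite (carrier G)" and "order G = n"
    and "S \<subseteq> carrier G" and "S \<inter> set_inv\<^bsub>G\<^esub> S = {}"
  shows "\<not> (\<exists>u\<in>carrier G. \<exists>v\<in>carrier G. \<exists>(t::real) (\<alpha>::real) (\<beta>::real).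
            u \<noteq> v \<and> \<alpha> \<noteq> 0 \<and> \<beta> \<noteq> 0 \<and> admits_FR (Cay G S) \<alpha> \<beta> u v t)"
proof
  interpret comm_group G by fact
  interpret \<Gamma>: oriented_graph "Cay G S"
    using assms by (intro oriented_graph_Cay) (auto intro: is_group)
  have V: "pverts (Cay G S) = carrier G" by (simp add: Cay_def)
  assume "\<exists>u\<in>carrier G. \<exists>v\<in>carrier G. \<exists>(t::real) (\<alpha>::real) (\<beta>::real).
            u \<noteq> v \<and> \<alpha> \<noteq> 0 \<and> \<beta> \<noteq> 0 \<and> admits_FR (Cay G S) \<alpha> \<beta> u v t"
  then obtain u v t \<alpha> \<beta> where uv: "u \<in> carrier G" "v \<in> carrier G" "u \<noteq> v"
    and nz: "\<alpha> \<noteq> 0" "\<beta> \<noteq> 0" and FR: "admits_FR (Cay G S) \<alpha> \<beta> u v t" by blast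
  let ?U = "transition (Cay G S) t"
  define h where "h = v \<otimes>\<^bsub>G\<^esub> inv\<^bsub>G\<^esub> u"
  define w where "w = h \<otimes>\<^bsub>G\<^esub> v"
  have h: "h \<in> carrier G" and hu: "h \<otimes>\<^bsub>G\<^esub> u = v"
    using uv by (auto simp: h_def m_assoc)
  have cancel: "h \<otimes>\<^bsub>G\<^esub> a = h \<otimes>\<^bsub>G\<^esub> b \<longleftrightarrow> a = b"
    if "a \<in> carrier G" "b \<in> carrier G" for a b
    using h that by simp
  have wv: "w \<noteq> v"
    \<comment> \<open>Otherwise \<open>h\<close> would send both \<open>u\<close> and
      \<open>v\<close> to \<open>v\<close>.\<close>
    using uv hu cancel[OF uv(2,1)] by (auto simp: w_def)
  have col_u: "?U x u = \<alpha> * unit_vec u x + \<beta> * unit_vec v x" if "x \<in> carrier G" for x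
    using FR that uv assms(2) by (simp add: admits_FR_def V mat_vec_unit)
  have col_v: "?U x v = \<alpha> * unit_vec v x + \<beta> * unit_vec w x" if x: "x \<in> carrier G" for x
  proof -
    \<comment> \<open>Pulling \<open>x\<close> back along the translation turns an entry of column
      \<open>v\<close> into one of the known column \<open>u\<close>.\<close>
    define y where "y = inv\<^bsub>G\<^esub> h \<otimes>\<^bsub>G\<^esub> x"
    have y: "y \<in> carrier G" "x = h \<otimes>\<^bsub>G\<^esub> y"
      using h x by (auto simp: y_def simp flip: m_assoc)
    have "?U x v = ?U y u"
      using transition_Cay_translate[OF h y(1) uv(1)] hu y(2) by simp
    moreover have "x = v \<longleftrightarrow> y = u" "x = w \<longleftrightarrow> y = v"
      using cancel[OF y(1)] y(2) uv(1,2) hu by (auto simp: w_def)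
    ultimately show ?thesis
      using col_u[OF y(1)] by (simp add: unit_vec_def)
  qed
  have "0 = (\<Sum>x\<in>carrier G. ?U x u * ?U x v)"
    using \<Gamma>.transition_orthogonal[of u v t] uv by (simp add: V mat_one_def)
  \<comment> \<open>The supports {u, v} and {v, w} always meet in \<open>v\<close>, and also in
    \<open>u\<close> exactly when \<open>w = u\<close>; as \<open>u\<close>, \<open>v\<close> differ
    and \<open>v\<close>, \<open>w\<close> differ, each common vertex contributes one \<alpha> and
    one \<beta>.\<close>
  also have "\<dots> = (\<Sum>x\<in>carrier G. (if v = x then \<alpha> * \<beta> else 0)
      + (if u = x then if u = w then \<alpha> * \<beta> else 0 else 0))"
    using uv wv by (intro sum.cong) (auto simp: col_u col_v unit_vec_def)
  also have "\<dots> = \<alpha> * \<beta> + (if u = w then \<alpha> * \<beta> else 0)"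
    using uv assms(2) by (simp add: sum.distrib)
  finally show False
    using nz by (auto split: if_splits)
qed

end
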